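(* Let $d,K,r,p,m\ge1$ be integers with $r\le d$ and $m\le d$, and set $D=\binom{d+p-1}{p}$ and $M=\binom{m+p-1}{p}$. Let $\mathcal V\subset\mathbb R^d$ be a generic union of $K$ $r$-dimensional subspaces, let $\mathcal S\subset\mathbb R^D$ be its $p$-th order tensorized subspace, and let $R=\dim\mathcal S$. Let $R'\le R$ be the dimension of the canonical projection $\mathcal S_\upsilon$ of $\mathcal S$ onto any tensorized observation pattern $\upsilon$ of size $m$ (for generic $\mathcal V$ this dimension is the same for all such $\upsilon$). If $\mathcal S$ is uniquely identifiable from its canonical projections onto all possible tensorized observation patterns of size $m$, then $$\binom{d}{m}\,(M-R')\ \ge\ D-R.$$
   Context: Tensorization: for $x\in\mathbb R^d$, $x^{\otimes p}\in\mathbb R^D$ with $D=\binom{d+p-1}{p}$ denotes the vector whose coordinates are indexed by tuples $1\le k_1\le\cdots\le k_p\le d$, the coordinate $(k_1,\dots,k_p)$ being $x_{k_1}\cdots x_{k_p}$. The $p$-th order tensorized subspace of a set $\mathcal V\subset\mathbb R^d$ is $\mathcal S=\operatorname{span}\{x^{\otimes p}:x\in\mathcal V\}\subset\mathbb R^D$. Genericity: a statement holds for a generic union of $K$ $r$-dimensional subspaces of $\mathbb R^d$ if it holds for $\mathcal V=\mathcal U_1\cup\cdots\cup\mathcal U_K$ for all tuples $(\mathcal U_1,\dots,\mathcal U_K)$ in some open dense subset of $\mathbb G(r,\mathbb R^d)\times\cdots\times\mathbb G(r,\mathbb R^d)$ ($K$ factors), where $\mathbb G(r,\mathbb R^d)$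 is the Grassmannian of $r$-dimensional subspaces of $\mathbb R^d$. Observation patterns: for a binary vector $\omega$, $|\omega|$ is its number of ones. For $\omega\in\{0,1\}^d$, $\omega^{\otimes p}\in\{0,1\}^D$ is called a tensorized observation pattern; it has size $m$ if $|\omega|=m$ (so there are $\binom dm$ patterns of size $m$, each with $\binom{m+p-1}{p}$ ones). For $\upsilon\in\{0,1\}^D$, $\mathcal S_\upsilon=\{y_\upsilon:y\in\mathcal S\}\subset\mathbb R^{|\upsilon|}$, where $y_\upsilon$ is the restriction of $y$ to the coordinates where $\upsilon$ equals one, is the canonical projection of $\mathcal S$ onto $\upsilon$. A subspace $\mathcal S\subset\mathbb R^D$ is uniquely identifiable from its canonical projections onto patterns $\upsilon_1,\dots,\upsilon_n$ if the only subspace $\mathcal S'\subset\mathbb R^D$ with $\mathcal S'_{\upsilon_i}=\mathcal S_{\upsilon_i}$ for all $i$ is $\mathcal S'=\mathcal S$. *)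

theory Defs
  imports "HOL-Analysis.Analysis"
begin

text \<open>
  The space \<open>R^d\<close> is \<open>real ^ 'd\<close> with \<open>d = CARD('d)\<close>, and the tensor order is \<open>p = CARD('p)\<close>.
  A tuple \<open>k_1 \<le> \<dots> \<le> k_p\<close> of indices is a monotone function from \<open>'p\<close> to \<open>'d\<close>; these
  tuples form the coordinate index type of \<open>R^D\<close>.
\<close>

typedef (overloaded) ('d, 'p) sym_idx =
  "{k :: 'p::{finite,linorder} \<Rightarrow> 'd::{finite,linorder}. mono k}"
  by (rule exI[of _ "\<lambda>_. undefined"]) (simp add: mono_def)

instance sym_idx :: ("{finite,linorder}", "{finite,linorder}") finite
proof
  have "finite (range (Rep_sym_idx :: ('a, 'b) sym_idx \<Rightarrow> _))"
    by simp
  thus "finite (UNIV :: ('a, 'b) sym_idx set)"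
    by (rule finite_imageD) (simp add: inj_def Rep_sym_idx_inject)
qed

definition tensor_power ::
    "real ^ 'd::{finite,linorder} \<Rightarrow> real ^ ('d, 'p::{finite,linorder}) sym_idx" where
  "tensor_power x = (\<chi> k. \<Prod>j\<in>UNIV. x $ Rep_sym_idx k j)"

definition tensorized_subspace ::
    "(real ^ 'd::{finite,linorder}) set \<Rightarrow> (real ^ ('d, 'p::{finite,linorder}) sym_idx) set" where
  "tensorized_subspace V = span (tensor_power ` V)"


text \<open>
  The Grassmannian of \<open>r\<close>-dimensional subspaces carries the quotient topology induced by the
  map sending a linearly independent \<open>r\<close>-tuple of vectors to its span.
\<close>

definition frames :: "nat \<Rightarrow> (nat \<Rightarrow> 'a::euclidean_space) topology" where
  "frames r = subtopology (product_topology (\<lambda>_. euclidean) {..<r})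
                {B. inj_on B {..<r} \<and> independent (B ` {..<r})}"

definition grassmannian :: "nat \<Rightarrow> 'a::euclidean_space set topology" where
  "grassmannian r = topology (\<lambda>W. W \<subseteq> {U. subspace U \<and> dim U = r} \<and>
     openin (frames r) {B \<in> topspace (frames r). span (B ` {..<r}) \<in> W})"

lemma openin_grassmannian:
  "openin (grassmannian r) W \<longleftrightarrow> W \<subseteq> {U. subspace U \<and> dim U = r} \<and>
     openin (frames r) {B \<in> topspace (frames r). span (B ` {..<r}) \<in> W}"
proof -
  let ?q = "\<lambda>W. {B \<in> topspace (frames r). span (B ` {..<r}) \<in> W}"
  have "istopology (\<lambda>W. W \<subseteq> {U :: 'a set. subspace U \<and> dim U = r} \<and> openin (frames r) (?q W))"
    unfolding istopology_def
  proof (rule conjI; intro allI impI)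
    fix S T :: "'a set set"
    assume "S \<subseteq> {U. subspace U \<and> dim U = r} \<and> openin (frames r) (?q S)"
      and "T \<subseteq> {U. subspace U \<and> dim U = r} \<and> openin (frames r) (?q T)"
    moreover have "?q (S \<inter> T) = ?q S \<inter> ?q T"
      by blast
    ultimately show "S \<inter> T \<subseteq> {U. subspace U \<and> dim U = r} \<and> openin (frames r) (?q (S \<inter> T))"
      by auto
  next
    fix \<K> :: "'a set set set"
    assume *: "\<forall>S\<in>\<K>. S \<subseteq> {U. subspace U \<and> dim U = r} \<and> openin (frames r) (?q S)"
    have "?q (\<Union>\<K>) = (\<Union>S\<in>\<K>. ?q S)"
      by blast
    with * show "\<Union>\<K> \<subseteq> {U. subspace U \<and> dim U = r} \<and> openin (frames r) (?q (\<Union>\<K>))"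
      by (auto intro!: openin_Union)
  qed
  thus ?thesis
    by (simp add: grassmannian_def topology_inverse')
qed

lemma topspace_frames:
  "topspace (frames r) =
     {B \<in> extensional {..<r}. inj_on B {..<r} \<and> independent (B ` {..<r})}"
  by (auto simp: frames_def PiE_def)

lemma topspace_grassmannian:
  "topspace (grassmannian r) = {U :: 'a::euclidean_space set. subspace U \<and> dim U = r}"
proof
  show "topspace (grassmannian r) \<subseteq> {U :: 'a set. subspace U \<and> dim U = r}"
    using openin_topspace[of "grassmannian r"] unfolding openin_grassmannian by blast
  have "dim (span (B ` {..<r})) = r" if "B \<in> topspace (frames r)" for B :: "nat \<Rightarrow> 'a"
    using that by (simp add: topspace_frames dim_eq_card_independent card_image)
  hence "{B \<in> topspace (frames r). span (B ` {..<r}) \<in> {U :: 'a set. subspace U \<and> dim U = r}}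
          = topspace (frames r)"
    by auto
  hence "openin (grassmannian r) {U :: 'a set. subspace U \<and> dim U = r}"
    unfolding openin_grassmannian by simp
  thus "{U :: 'a set. subspace U \<and> dim U = r} \<subseteq> topspace (grassmannian r)"
    by (rule openin_subset)
qed

lemma quotient_map_grassmannian:
  "quotient_map (frames r) (grassmannian r :: 'a::euclidean_space set topology)
     (\<lambda>B. span (B ` {..<r}))"
  unfolding quotient_map_def
proof (intro conjI allI impI)
  show "(\<lambda>B. span (B ` {..<r})) ` topspace (frames r) =
          topspace (grassmannian r :: 'a set topology)"
  proof
    show "(\<lambda>B. span (B ` {..<r})) ` topspace (frames r) \<subseteq>
            topspace (grassmannian r :: 'a set topology)"
      by (auto simp: topspace_frames topspace_grassmannian dim_eq_card_independent card_image)
    show "topspace (grassmannian r :: 'a set topology) \<subseteq>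
            (\<lambda>B. span (B ` {..<r})) ` topspace (frames r)"
    proof
      fix U :: "'a set"
      assume "U \<in> topspace (grassmannian r)"
      hence U: "subspace U" "dim U = r"
        by (auto simp: topspace_grassmannian)
      obtain A where A: "A \<subseteq> U" "independent A" "U \<subseteq> span A" "card A = r"
        using basis_exists[of U] U by metis
      have "finite A"
        using A independent_imp_finite by blast
      then obtain f where f: "bij_betw f {..<r} A"
        using A(4) ex_bij_betw_nat_finite[of A] by (auto simp: atLeast0LessThan)
      let ?B = "restrict f {..<r}"
      have img: "?B ` {..<r} = A"
        using f by (simp add: bij_betw_def)
      moreover have "inj_on ?B {..<r}"
        using f by (simp add: bij_betw_def inj_on_def)
      ultimately have "?B \<in> topspace (frames r)"
        using A by (simp add: topspace_frames)
      moreover have "span A = U"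
        using A U span_subspace by blast
      ultimately show "U \<in> (\<lambda>B. span (B ` {..<r})) ` topspace (frames r)"
        using img by (intro image_eqI[of _ _ ?B]) auto
    qed
  qed
next
  fix W :: "'a set set"
  assume "W \<subseteq> topspace (grassmannian r)"
  thus "openin (frames r) {B \<in> topspace (frames r). span (B ` {..<r}) \<in> W} =
          openin (grassmannian r) W"
    by (auto simp: openin_grassmannian topspace_grassmannian)
qed

definition generic_union ::
    "nat \<Rightarrow> nat \<Rightarrow> ('a::euclidean_space set \<Rightarrow> bool) \<Rightarrow> bool" where
  "generic_union K r P \<longleftrightarrow>
     (let X = product_topology (\<lambda>_. grassmannian r) {..<K}
      in \<exists>G. openin X G \<and> X closure_of G = topspace X \<and> (\<forall>U\<in>G. P (\<Union>i<K. U i)))"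


text \<open>Binary vectors are real vectors with entries in \<open>{0, 1}\<close>.\<close>

definition tensorized_patterns ::
    "nat \<Rightarrow> (real ^ ('d::{finite,linorder}, 'p::{finite,linorder}) sym_idx) set" where
  "tensorized_patterns m =
     {tensor_power \<omega> |\<omega>. (\<forall>i. \<omega> $ i \<in> {0, 1}) \<and> card {i. \<omega> $ i = 1} = m}"

text \<open>
  The target space, whose coordinates are those where \<open>\<upsilon>\<close> equals one, is represented as the
  coordinate subspace of the ambient space in which all other coordinates vanish.
\<close>

definition restrict_coords :: "real ^ 'n \<Rightarrow> real ^ 'n \<Rightarrow> real ^ 'n" where
  "restrict_coords \<upsilon> y = (\<chi> k. if \<upsilon> $ k = 1 then y $ k else 0)"

definition canonical_projection :: "(real ^ 'n) set \<Rightarrow> real ^ 'n \<Rightarrow> (real ^ 'n) set" where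
  "canonical_projection S \<upsilon> = restrict_coords \<upsilon> ` S"

definition uniquely_identifiable :: "(real ^ 'n) set \<Rightarrow> (real ^ 'n) set \<Rightarrow> bool" where
  "uniquely_identifiable S \<Upsilon> \<longleftrightarrow>
     (\<forall>S'. subspace S' \<and>
           (\<forall>\<upsilon>\<in>\<Upsilon>. canonical_projection S' \<upsilon> = canonical_projection S \<upsilon>) \<longrightarrow> S' = S)"

end

theory Submission
  imports Defs
begin

text \<open>
  For the inequality, let \<open>N\<^sub>\<upsilon>\<close> be the space of vectors that are supported on the pattern \<open>\<upsilon>\<close> and
  orthogonal to \<open>S\<close>; its dimension is \<open>M - R'\<close>. The orthogonal complement of the sum of all
  \<open>N\<^sub>\<upsilon>\<close> has the same canonical projections as \<open>S\<close>, so identifiability forces the \<open>N\<^sub>\<upsilon>\<close> to span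
  the whole orthogonal complement of \<open>S\<close>, which has dimension \<open>D - R\<close>.

  For the genericity of \<open>R'\<close>, parametrise unions of subspaces by tuples of frames. A lower bound on
  the rank of a projection is certified by a nonvanishing determinant, which is a polynomial in the
  frame entries; hence the maximal rank is attained on an open dense set of frame tuples. Permuting
  the coordinates shows that the maximal rank is the same for all patterns of size \<open>m\<close>. Finally,
  the span map from frames to the Grassmannian is continuous and open, so it carries open dense sets
  to open dense sets.
\<close>


section \<open>Linear algebra and the codimension bound\<close>

lemma det_nonzero_imp_independent_rows:
  fixes X :: "real^'n^'n"
  assumes "det X \<noteq> 0"
  shows "inj (\<lambda>i. X $ i)" "independent (range (\<lambda>i. X $ i))"
proof -
  let ?R = "range (\<lambda>i. X $ i)"
  have rows: "rows X = ?R"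
    by (auto simp: rows_def row_def vec_nth_inverse)
  have "CARD('n) \<le> dim ?R"
    using assms det_eq_0_rank[of X] by (simp add: row_rank_def rows)
  moreover have "dim ?R \<le> card ?R" "card ?R \<le> CARD('n)"
    by (auto intro!: dim_le_card card_image_le span_superset)
  ultimately have "card ?R = CARD('n)" "dim ?R = card ?R"
    by auto
  then show "inj (\<lambda>i. X $ i)" "independent ?R"
    using card_le_dim_spanning[of ?R ?R] by (auto intro: eq_card_imp_inj_on span_base)
qed

lemma independent_rows_imp_det_nonzero:
  fixes X :: "real^'n^'n"
  assumes "inj (\<lambda>i. X $ i)" "independent (range (\<lambda>i. X $ i))"
  shows "det X \<noteq> 0"
proof -
  have "rows X = range (\<lambda>i. X $ i)"
    by (auto simp: rows_def row_def vec_nth_inverse)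
  then have "rank X = CARD('n)"
    using assms by (simp add: row_rank_def dim_eq_card_independent card_image)
  then show ?thesis
    by (simp add: det_eq_0_rank)
qed

text \<open>\<open>\<beta>\<close> will enumerate a basis containing \<open>A\<close>. The basis
  vectors outside \<open>A\<close> pad the images \<open>u x\<close> to a square matrix, so that a
  determinant can test them even when \<open>A\<close> has fewer than \<open>CARD('n)\<close>
  elements.\<close>

definition completed_matrix :: "('n \<Rightarrow> real^'n) \<Rightarrow> (real^'n) set \<Rightarrow> (real^'n \<Rightarrow> real^'n) \<Rightarrow> real^'n^'n"
  where "completed_matrix \<beta> A u = (\<chi> i. if \<beta> i \<in> A then u (\<beta> i) else \<beta> i)"

text \<open>Extend \<open>A\<close> to a basis and let \<open>\<beta>\<close> enumerate it. The
  identity substitution gives back the basis itself. For general \<open>u\<close>, each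
  \<open>u x\<close> with \<open>x\<close> in \<open>A\<close> is a row, at a position belonging to
  \<open>x\<close> alone, so independence of all rows passes to these.\<close>

lemma independent_completed_matrix:
  fixes A :: "(real^'n) set"
  assumes "independent A"
  obtains \<beta> where "det (completed_matrix \<beta> A (\<lambda>x. x)) \<noteq> 0"
    "\<And>u. det (completed_matrix \<beta> A u) \<noteq> 0 \<Longrightarrow> inj_on u A \<and> independent (u ` A)"
proof -
  obtain B where B: "A \<subseteq> B" "independent B" "span B = UNIV"
    using maximal_independent_subset_extend[of A UNIV] assms by (metis subset_UNIV top.extremum_uniqueI)
  have "finite B" "card B = CARD('n)"
    using B independent_imp_finite dim_eq_card_independent[of B] dim_span[of B] by auto
  then obtain \<beta> :: "'n \<Rightarrow> real^'n" where \<beta>: "bij_betw \<beta> UNIV B"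
    using finite_same_card_bij[of "UNIV :: 'n set" B] by auto
  then have inj: "inj \<beta>" and img: "range \<beta> = B"
    by (auto simp: bij_betw_def)
  have id: "($) (completed_matrix \<beta> A (\<lambda>x. x)) = \<beta>"
    by (auto simp: completed_matrix_def)
  have "det (completed_matrix \<beta> A (\<lambda>x. x)) \<noteq> 0"
    by (rule independent_rows_imp_det_nonzero; unfold id; use inj img B in simp)
  moreover have "inj_on u A \<and> independent (u ` A)" if u: "det (completed_matrix \<beta> A u) \<noteq> 0" for u
  proof
    let ?X = "completed_matrix \<beta> A u"
    have row: "\<exists>i. x = \<beta> i \<and> ?X $ i = u x" if "x \<in> A" for x
      using that B img by (force simp: completed_matrix_def)
    show "inj_on u A"
    proof
      fix x y assume "x \<in> A" "y \<in> A" "u x = u y"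
      then show "x = y"
        using row[of x] row[of y] det_nonzero_imp_independent_rows(1)[OF u] by (metis injD)
    qed
    have "u ` A \<subseteq> range (($) ?X)"
      using row by (metis image_subsetI rangeI)
    then show "independent (u ` A)"
      using det_nonzero_imp_independent_rows(2)[OF u] independent_mono by blast
  qed
  ultimately show thesis
    by (rule that)
qed

text \<open>The coefficients are attached to indices and not to vectors, so they can be kept fixed
  while the vectors \<open>f i\<close> are deformed.\<close>

lemma mem_span_image_finite:
  fixes f :: "'b \<Rightarrow> 'a::real_vector"
  assumes "finite I" "x \<in> span (f ` I)"
  obtains c where "x = (\<Sum>i\<in>I. c i *\<^sub>R f i)"
proof -
  have "\<exists>c. x = (\<Sum>i\<in>I. c i *\<^sub>R f i)"
    using assms(2)
  proof (induction rule: span_induct_alt)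
    case base
    show ?case by (rule exI[of _ "\<lambda>_. 0"]) simp
  next
    case (step a y z)
    then obtain i c where i: "i \<in> I" "y = f i" "z = (\<Sum>i\<in>I. c i *\<^sub>R f i)" by blast
    have "a *\<^sub>R y + z = (\<Sum>j\<in>I. (c j + (if j = i then a else 0)) *\<^sub>R f j)"
      using i assms(1) by (simp add: scaleR_add_left sum.distrib if_distrib[of "\<lambda>t. t *\<^sub>R _"] cong: if_cong)
    then show ?case by (rule exI[of _ "\<lambda>j. c j + (if j = i then a else 0)"])
  qed
  then show thesis using that by blast
qed

section \<open>Dimension of a union and the codimension bound\<close>

lemma dim_UN_le:
  fixes N :: "'i \<Rightarrow> 'a::euclidean_space set"
  assumes "finite I"
  shows "dim (\<Union>i\<in>I. N i) \<le> (\<Sum>i\<in>I. dim (N i))"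
proof -
  have "\<exists>B. B \<subseteq> N i \<and> independent B \<and> N i \<subseteq> span B \<and> card B = dim (N i)" for i
    using basis_exists[of "N i"] by metis
  then obtain B where B: "\<And>i. independent (B i)" "\<And>i. N i \<subseteq> span (B i)" "\<And>i. card (B i) = dim (N i)"
    by metis
  have "(\<Union>i\<in>I. N i) \<subseteq> span (\<Union>i\<in>I. B i)"
    using B(2) by (blast intro: subsetD[OF span_mono, rotated])
  moreover have "finite (\<Union>i\<in>I. B i)"
    using assms B(1) independent_imp_finite by blast
  ultimately have "dim (\<Union>i\<in>I. N i) \<le> card (\<Union>i\<in>I. B i)"
    by (rule dim_le_card)
  also have "\<dots> \<le> (\<Sum>i\<in>I. card (B i))"
    using assms by (rule card_UN_le)
  finally show ?thesis by (simp add: B(3))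
qed

lemma linear_restrict_coords: "linear (restrict_coords \<upsilon>)"
  by (rule linearI) (auto simp: restrict_coords_def vec_eq_iff)

lemma dim_coordinate_subspace:
  "dim {x :: real^'n. \<forall>k. k \<notin> J \<longrightarrow> x $ k = 0} = card J"
  using dim_substandard_cart[of J, where 'a = real] by (simp add: dim_vec_eq)

lemma identifiable_codim_le:
  fixes S :: "(real^'n) set" and \<Upsilon> :: "(real^'n) set"
  assumes S: "subspace S" and fin: "finite \<Upsilon>" and uniq: "uniquely_identifiable S \<Upsilon>"
  shows "int CARD('n) - int (dim S) \<le>
    (\<Sum>\<upsilon>\<in>\<Upsilon>. int (card {k. \<upsilon> $ k = 1}) - int (dim (canonical_projection S \<upsilon>)))"
proof -
  define E where "E \<upsilon> = {x :: real^'n. \<forall>k. k \<notin> {k. \<upsilon> $ k = 1} \<longrightarrow> x $ k = 0}" for \<upsilon> :: "real^'n"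
  define N where "N \<upsilon> = {y \<in> E \<upsilon>. \<forall>x\<in>canonical_projection S \<upsilon>. orthogonal x y}" for \<upsilon>
  have subE: "subspace (E \<upsilon>)" for \<upsilon>
    by (auto simp: E_def subspace_def)
  have sub: "subspace (canonical_projection T \<upsilon>)" if "subspace T" for T \<upsilon>
    unfolding canonical_projection_def
    using linear_subspace_image[OF linear_restrict_coords that] .
  have restrE: "restrict_coords \<upsilon> y \<in> E \<upsilon>" for \<upsilon> y
    by (simp add: restrict_coords_def E_def)
  have projE: "canonical_projection T \<upsilon> \<subseteq> E \<upsilon>" for T \<upsilon>
    using restrE by (auto simp: canonical_projection_def)
  have dimN: "int (dim (N \<upsilon>)) =
      int (card {k. \<upsilon> $ k = 1}) - int (dim (canonical_projection S \<upsilon>))" for \<upsilon>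
    using dim_subspace_orthogonal_to_vectors[OF sub[OF S] subE projE, of \<upsilon>]
      dim_coordinate_subspace[of "{k. \<upsilon> $ k = 1}"]
    by (simp add: N_def E_def)
  \<comment> \<open>Pairing with a vector supported on the pattern ignores the coordinates that the
    restriction kills. This turns orthogonality to a projection into orthogonality to the original
    vector and back.\<close>
  have inner_restr: "inner a (restrict_coords \<upsilon> y) = inner a y" if "a \<in> E \<upsilon>" for a \<upsilon> y
    using that by (auto simp: inner_vec_def E_def restrict_coords_def intro!: sum.cong)
  define S' where "S' = {y. \<forall>a\<in>span (\<Union>\<upsilon>\<in>\<Upsilon>. N \<upsilon>). orthogonal a y}"
  have S'_alt: "S' = {y. \<forall>\<upsilon>\<in>\<Upsilon>. \<forall>a\<in>N \<upsilon>. orthogonal a y}"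
  proof
    show "{y. \<forall>\<upsilon>\<in>\<Upsilon>. \<forall>a\<in>N \<upsilon>. orthogonal a y} \<subseteq> S'"
      unfolding S'_def using orthogonal_to_span orthogonal_commute by blast
  qed (auto simp: S'_def intro: span_base)
  have subS': "subspace S'"
    by (auto simp: S'_def subspace_def orthogonal_clauses)
  have "S \<subseteq> S'"
  proof
    fix y assume y: "y \<in> S"
    have "orthogonal a y" if "a \<in> N \<upsilon>" for a \<upsilon>
    proof -
      have "a \<in> E \<upsilon>" "orthogonal (restrict_coords \<upsilon> y) a"
        using that y by (auto simp: N_def canonical_projection_def)
      then show ?thesis
        using inner_restr by (simp add: orthogonal_def inner_commute)
    qed
    then show "y \<in> S'"
      by (auto simp: S'_alt)
  qed
  have "canonical_projection S' \<upsilon> = canonical_projection S \<upsilon>" if "\<upsilon> \<in> \<Upsilon>" for \<upsilon>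
  proof
    show "canonical_projection S \<upsilon> \<subseteq> canonical_projection S' \<upsilon>"
      using \<open>S \<subseteq> S'\<close> by (auto simp: canonical_projection_def)
    show "canonical_projection S' \<upsilon> \<subseteq> canonical_projection S \<upsilon>"
    proof
      fix w assume "w \<in> canonical_projection S' \<upsilon>"
      then obtain y where y: "y \<in> S'" "w = restrict_coords \<upsilon> y"
        by (auto simp: canonical_projection_def)
      let ?P = "canonical_projection S \<upsilon>"
      \<comment> \<open>Split \<open>w\<close> into its part \<open>s\<close> in the projection of
        \<open>S\<close> and an orthogonal remainder \<open>z\<close>. The remainder lies in
        \<open>N \<upsilon>\<close>, hence is orthogonal to \<open>y\<close> and so to
        \<open>w\<close>; being orthogonal to \<open>s\<close> as well, it is orthogonal to
        itself.\<close>
      obtain s z where sz: "s \<in> span ?P" "\<And>t. t \<in> span ?P \<Longrightarrow> orthogonal z t" "w = s + z"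
        using orthogonal_subspace_decomp_exists[of ?P w] by metis
      have s: "s \<in> ?P"
        using sz sub[OF S] span_eq_iff by blast
      have "z = w - s" using sz by simp
      then have "z \<in> E \<upsilon>"
        using s projE restrE y subE by (metis subsetD subspace_diff)
      then have z: "z \<in> N \<upsilon>"
        using sz(2) by (auto simp: N_def span_base orthogonal_commute)
      then have "orthogonal z y"
        using y that by (auto simp: S'_alt)
      then have "inner z w = 0"
        using inner_restr[OF \<open>z \<in> E \<upsilon>\<close>] y by (simp add: orthogonal_def)
      moreover have "inner z s = 0"
        using sz by (simp add: orthogonal_def)
      ultimately have "z = 0"
        using sz(3) by (simp add: inner_add_right)
      then show "w \<in> ?P"
        using sz s by simp
    qed
  qed
  then have "S' = S"
    using uniq subS' by (auto simp: uniquely_identifiable_def)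
  \<comment> \<open>\<open>S\<close> is now the full orthogonal complement of the span of all
    \<open>N \<upsilon>\<close>, so the two dimensions add up to that of the whole space.\<close>
  then have "dim S + dim (\<Union>\<upsilon>\<in>\<Upsilon>. N \<upsilon>) = CARD('n)"
    using dim_subspace_orthogonal_to_vectors[of "span (\<Union>\<upsilon>\<in>\<Upsilon>. N \<upsilon>)" UNIV]
    by (simp add: S'_def)
  moreover have "dim (\<Union>\<upsilon>\<in>\<Upsilon>. N \<upsilon>) \<le> (\<Sum>\<upsilon>\<in>\<Upsilon>. dim (N \<upsilon>))"
    using fin by (rule dim_UN_le)
  ultimately show ?thesis
    by (simp flip: dimN of_nat_sum)
qed


section \<open>Tensor powers and coordinate permutations\<close>

lemma mono_with_image_mset:
  fixes M :: "'d::linorder multiset"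
  assumes "size M = CARD('p::{finite,linorder})"
  obtains k :: "'p::{finite,linorder} \<Rightarrow> 'd" where "mono k" "image_mset k (mset_set UNIV) = M"
proof -
  define ms where "ms = sorted_list_of_multiset M"
  \<comment> \<open>The zero-based rank of \<open>j\<close> in the order of \<open>'p\<close>:
    strictly increasing, hence a bijection onto the positions of the sorted list
    \<open>ms\<close>.\<close>
  define h where "h j = card {..<j}" for j :: 'p
  have len: "length ms = CARD('p)"
    using assms by (metis ms_def mset_sorted_list_of_multiset size_mset)
  have h_less: "h i < h j" if "i < j" for i j
    unfolding h_def using that by (intro psubset_card_mono) auto
  have h_lt: "h j < CARD('p)" for j
    unfolding h_def by (intro psubset_card_mono) auto
  have h_mono: "h i \<le> h j" if "i \<le> j" for i j
    unfolding h_def using that by (intro card_mono) auto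
  have inj: "inj h"
    by (rule linorder_injI) (use h_less in fastforce)
  have ran: "range h = {0..<CARD('p)}"
    by (rule card_subset_eq) (use h_lt inj in \<open>auto simp: card_image\<close>)
  let ?k = "\<lambda>j. ms ! h j"
  have "mono ?k"
    using h_mono h_lt len by (auto simp: mono_def ms_def intro!: sorted_nth_mono)
  moreover have "image_mset ?k (mset_set UNIV) = image_mset ((!) ms) (image_mset h (mset_set UNIV))"
    by (simp add: multiset.map_comp comp_def)
  moreover have "\<dots> = mset (map ((!) ms) [0..<length ms])"
    by (simp add: image_mset_mset_set[OF inj] ran len)
  moreover have "\<dots> = M"
    by (simp only: map_nth) (simp add: ms_def)
  ultimately show thesis
    using that by metis
qed

text \<open>Read along the sorted list of all arguments, a monotone function lists its values in
  sorted order, and a sorted list is determined by its multiset.\<close>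

lemma mono_eqI_image_mset:
  fixes k l :: "'p::{finite,linorder} \<Rightarrow> 'd::linorder"
  assumes "mono k" "mono l" "image_mset k (mset_set UNIV) = image_mset l (mset_set UNIV)"
  shows "k = l"
proof -
  define ps where "ps = sorted_list_of_set (UNIV :: 'p set)"
  have ps: "set ps = UNIV" "sorted ps" "mset ps = mset_set UNIV"
    by (auto simp: ps_def simp flip: sorted_list_of_mset_set)
  have "sorted (map f ps)" if "mono f" for f :: "'p \<Rightarrow> 'd"
    using ps(2) that by (auto simp: sorted_iff_nth_mono mono_def)
  moreover have "mset (map k ps) = mset (map l ps)"
    using assms(3) ps(3) by simp
  ultimately have "map k ps = map l ps"
    using assms(1,2) properties_for_sort by (metis sorted_sort_id)
  then show ?thesis
    using ps(1) by auto
qed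

text \<open>A product of coordinates depends only on the multiset of indices, so an unsorted tuple
  \<open>g\<close> may be replaced by its sorted rearrangement \<open>k\<close>, uniformly in
  \<open>x\<close>.\<close>

lemma prod_coord_eq_tensor_power:
  fixes g :: "'p::{finite,linorder} \<Rightarrow> 'd::{finite,linorder}"
  obtains k :: "('d::{finite,linorder}, 'p::{finite,linorder}) sym_idx" where "\<And>x. (\<Prod>j\<in>UNIV. x $ g j) = tensor_power x $ k"
proof -
  obtain k :: "'p \<Rightarrow> 'd"
    where k: "mono k" "image_mset k (mset_set UNIV) = image_mset g (mset_set UNIV)"
    by (rule mono_with_image_mset[of "image_mset g (mset_set UNIV)"]) auto
  have *: "(\<Prod>j\<in>UNIV. x $ f j) = prod_mset (image_mset (($) x) (image_mset f (mset_set UNIV)))"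
    for x :: "real^'d::{finite,linorder}" and f :: "'p \<Rightarrow> 'd"
    by (simp add: prod_unfold_prod_mset multiset.map_comp comp_def)
  have "(\<Prod>j\<in>UNIV. x $ g j) = tensor_power x $ Abs_sym_idx k" for x
    using k(1) by (simp add: tensor_power_def Abs_sym_idx_inverse) (simp add: * k(2))
  then show thesis by (rule that)
qed

text \<open>Monotone tuples with entries in \<open>I\<close> correspond to multisets over
  \<open>I\<close> of size \<open>CARD('p)\<close>. The full index set yields \<open>D\<close>, and
  a set of size \<open>m\<close> yields \<open>M\<close>.\<close>

lemma card_sym_idx_range:
  fixes I :: "'d::{finite,linorder} set"
  shows "card {k :: ('d, 'p::{finite,linorder}) sym_idx. range (Rep_sym_idx k) \<subseteq> I} =
    (card I + CARD('p) - 1) choose CARD('p)"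
proof -
  let ?A = "{k :: ('d, 'p) sym_idx. range (Rep_sym_idx k) \<subseteq> I}"
  let ?f = "\<lambda>k :: ('d, 'p) sym_idx. image_mset (Rep_sym_idx k) (mset_set UNIV)"
  have "inj_on ?f ?A"
  proof
    fix k l :: "('d, 'p) sym_idx" assume "?f k = ?f l"
    then have "Rep_sym_idx k = Rep_sym_idx l"
      using Rep_sym_idx[of k] Rep_sym_idx[of l] by (intro mono_eqI_image_mset) auto
    then show "k = l" by (simp add: Rep_sym_idx_inject)
  qed
  moreover have "?f ` ?A = multisets_of_size I CARD('p)"
  proof
    show "?f ` ?A \<subseteq> multisets_of_size I CARD('p)"
      by (auto simp: multisets_of_size_def)
    show "multisets_of_size I CARD('p) \<subseteq> ?f ` ?A"
    proof
      fix M assume M: "M \<in> multisets_of_size I CARD('p)"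
      then obtain k :: "'p \<Rightarrow> 'd" where k: "mono k" "image_mset k (mset_set UNIV) = M"
        using mono_with_image_mset[of M] by (auto simp: multisets_of_size_def)
      then have "range k \<subseteq> I"
        using M by (auto simp: multisets_of_size_def)
      with k show "M \<in> ?f ` ?A"
        by (intro image_eqI[of _ _ "Abs_sym_idx k"]) (auto simp: Abs_sym_idx_inverse)
    qed
  qed
  ultimately show ?thesis
    using card_multisets_of_size[of I "CARD('p)"] by (metis card_image finite)
qed

section \<open>Projections as spans of tensors of masked vectors\<close>

definition coord_mask :: "'d set \<Rightarrow> real^'d \<Rightarrow> real^'d" where
  "coord_mask I x = (\<chi> i. if i \<in> I then x $ i else 0)"

text \<open>These vectors will span the canonical projections. Zeroing coordinates before tensoring
  keeps everything expressed in R^d, where frames and coordinate permutations live.\<close>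

definition masked_tensors ::
    "'d set \<Rightarrow> (real^'d::{finite,linorder}) set \<Rightarrow> (real^('d, 'p::{finite,linorder}) sym_idx) set" where
  "masked_tensors I V = (\<lambda>x. tensor_power (coord_mask I x)) ` V"

lemma tensor_power_coord_mask:
  fixes k :: "('d::{finite,linorder}, 'p::{finite,linorder}) sym_idx"
  shows "tensor_power (coord_mask I x) $ k = (if range (Rep_sym_idx k) \<subseteq> I then tensor_power x $ k else 0)"
  by (auto simp: tensor_power_def coord_mask_def intro!: prod.cong)

lemma tensor_power_indicator:
  fixes k :: "('d::{finite,linorder}, 'p::{finite,linorder}) sym_idx"
  assumes "\<forall>i. \<omega> $ i \<in> {0, 1}"
  shows "tensor_power \<omega> $ k = (if range (Rep_sym_idx k) \<subseteq> {i. \<omega> $ i = 1} then 1 else 0)"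
proof -
  have "\<exists>j. \<omega> $ Rep_sym_idx k j = 0" if "\<not> range (Rep_sym_idx k) \<subseteq> {i. \<omega> $ i = 1}"
    using that assms by blast
  then show ?thesis
    by (auto simp: tensor_power_def intro!: prod.neutral)
qed

lemma card_ones_tensor_power:
  fixes \<omega> :: "real^'d::{finite,linorder}"
  assumes "\<forall>i. \<omega> $ i \<in> {0, 1}"
  shows "card {k :: ('d, 'p::{finite,linorder}) sym_idx. tensor_power \<omega> $ k = 1} =
    (card {i. \<omega> $ i = 1} + CARD('p) - 1) choose CARD('p)"
  using card_sym_idx_range[of "{i. \<omega> $ i = 1}", where 'p = 'p]
  by (simp add: tensor_power_indicator[OF assms])

text \<open>Restriction is linear, so it commutes with the span; on a single tensor power it amounts
  to masking the underlying vector, since a tuple survives exactly when all its indices lie in the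
  support of \<open>\<omega>\<close>.\<close>

lemma canonical_projection_tensorized:
  fixes \<omega> :: "real^'d::{finite,linorder}"
  assumes "\<forall>i. \<omega> $ i \<in> {0, 1}"
  shows "canonical_projection (tensorized_subspace V) (tensor_power \<omega>) =
    (span (masked_tensors {i. \<omega> $ i = 1} V) :: (real^('d, 'p::{finite,linorder}) sym_idx) set)"
proof -
  have "restrict_coords (tensor_power \<omega>) (tensor_power x) =
      (tensor_power (coord_mask {i. \<omega> $ i = 1} x) :: real^('d, 'p) sym_idx)" for x
    by (simp add: vec_eq_iff restrict_coords_def tensor_power_indicator[OF assms] tensor_power_coord_mask)
  then show ?thesis
    by (simp add: canonical_projection_def tensorized_subspace_def masked_tensors_def image_image
        flip: linear_span_image[OF linear_restrict_coords])
qed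

text \<open>A permutation taking \<open>J\<close> onto \<open>I\<close> acts on vectors by
  \<open>g\<close>. Undoing it on tensors is a linear reindexing \<open>\<Lambda>\<close>, which
  maps the tensors masked by \<open>I\<close> onto those masked by \<open>J\<close>; a linear image
  cannot have larger dimension.\<close>

lemma masked_tensors_permute:
  fixes I J :: "'d::{finite,linorder} set"
  assumes "card I = card J"
  obtains g :: "real^'d::{finite,linorder} \<Rightarrow> real^'d::{finite,linorder}" where "linear g" "inj g"
    "\<And>V. dim (masked_tensors J V ::
        (real^('d::{finite,linorder}, 'p::{finite,linorder}) sym_idx) set) \<le>
      dim (masked_tensors I (g ` V) ::
        (real^('d::{finite,linorder}, 'p::{finite,linorder}) sym_idx) set)"
proof -
  obtain f where f: "bij_betw f J I"
    using assms finite_same_card_bij[of J I] by auto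
  have "card (- J) = card (- I)"
    using assms by (simp add: Compl_eq_Diff_UNIV card_Diff_subset)
  then obtain f' where f': "bij_betw f' (- J) (- I)"
    using finite_same_card_bij[of "- J" "- I"] by auto
  \<comment> \<open>Glue the bijection from \<open>J\<close> to \<open>I\<close> with one between
    the complements, so that membership in \<open>J\<close> becomes membership in
    \<open>I\<close>.\<close>
  define \<pi> where "\<pi> i = (if i \<in> J then f i else f' i)" for i
  have "bij_betw \<pi> J I" "bij_betw \<pi> (- J) (- I)"
    using f f' bij_betw_cong[of J \<pi> f I] bij_betw_cong[of "- J" \<pi> f' "- I"] by (auto simp: \<pi>_def)
  then have "bij_betw \<pi> (J \<union> - J) (I \<union> - I)"
    by (rule bij_betw_combine) auto
  then have bij: "bij \<pi>" by simp
  have mem: "\<pi> i \<in> I \<longleftrightarrow> i \<in> J" for i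
    using f f' by (auto simp: \<pi>_def bij_betw_def)
  define g :: "real^'d::{finite,linorder} \<Rightarrow> real^'d::{finite,linorder}" where "g x = (\<chi> i. x $ inv \<pi> i)" for x
  have "linear g"
    by (rule linearI) (auto simp: g_def vec_eq_iff)
  moreover have gx: "g x $ \<pi> i = x $ i" for x i
    using bij by (simp add: g_def bij_is_inj)
  then have "inj g"
    by (metis injI vec_eq_iff)
  moreover have "dim (masked_tensors J V :: (real^('d, 'p) sym_idx) set) \<le>
         dim (masked_tensors I (g ` V) :: (real^('d, 'p) sym_idx) set)" for V
  proof -
    \<comment> \<open>Composing a monotone tuple with \<open>\<pi>\<close> may destroy monotonicity;
      \<open>\<sigma>\<close> picks a sorted tuple with the same coordinate products.\<close>
    have "\<exists>l :: ('d, 'p) sym_idx. \<forall>x. (\<Prod>j\<in>UNIV. x $ \<pi> (Rep_sym_idx k j)) = tensor_power x $ l"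
      for k :: "('d, 'p) sym_idx"
      using prod_coord_eq_tensor_power[of "\<lambda>j. \<pi> (Rep_sym_idx k j)"] by metis
    then obtain \<sigma> :: "('d, 'p) sym_idx \<Rightarrow> ('d, 'p) sym_idx"
      where \<sigma>: "\<And>k x. (\<Prod>j\<in>UNIV. x $ \<pi> (Rep_sym_idx k j)) = tensor_power x $ \<sigma> k"
      by metis
    define \<Lambda> :: "real^('d, 'p) sym_idx \<Rightarrow> real^('d, 'p) sym_idx" where "\<Lambda> y = (\<chi> k. y $ \<sigma> k)" for y
    have "coord_mask I (g x) $ \<pi> i = coord_mask J x $ i" for x i
      by (simp add: coord_mask_def mem gx)
    then have "\<Lambda> (tensor_power (coord_mask I (g x))) = tensor_power (coord_mask J x)" for x
      by (simp add: \<Lambda>_def vec_eq_iff flip: \<sigma>) (simp add: tensor_power_def)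
    then have "masked_tensors J V = \<Lambda> ` masked_tensors I (g ` V)"
      by (simp add: masked_tensors_def image_image)
    moreover have "linear \<Lambda>"
      by (rule linearI) (auto simp: \<Lambda>_def vec_eq_iff)
    ultimately show ?thesis
      using dim_image_le by metis
  qed
  ultimately show thesis
    using that by blast
qed


section \<open>Polynomial certificates and the topology of frames\<close>

text \<open>Polynomial functions generated by \<open>X\<close> over an arbitrary domain. Rule
  induction yields both facts wanted of them: continuity, and reduction to a one-variable polynomial
  along a line.\<close>

inductive poly_in :: "('a \<Rightarrow> real) set \<Rightarrow> ('a \<Rightarrow> real) \<Rightarrow> bool" for X where
  gen: "f \<in> X \<Longrightarrow> poly_in X f"
| const: "poly_in X (\<lambda>_. c)"
| add: "poly_in X f \<Longrightarrow> poly_in X g \<Longrightarrow> poly_in X (\<lambda>x. f x + g x)"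
| mult: "poly_in X f \<Longrightarrow> poly_in X g \<Longrightarrow> poly_in X (\<lambda>x. f x * g x)"

lemma poly_in_sum: "(\<And>i. i \<in> I \<Longrightarrow> poly_in X (f i)) \<Longrightarrow> poly_in X (\<lambda>x. \<Sum>i\<in>I. f i x)"
  by (induction I rule: infinite_finite_induct) (auto intro: poly_in.const poly_in.add)

lemma poly_in_prod: "(\<And>i. i \<in> I \<Longrightarrow> poly_in X (f i)) \<Longrightarrow> poly_in X (\<lambda>x. \<Prod>i\<in>I. f i x)"
  by (induction I rule: infinite_finite_induct) (auto intro: poly_in.const poly_in.mult)

lemma poly_in_det:
  assumes "\<And>i j. poly_in X (\<lambda>x. A x $ i $ j)"
  shows "poly_in X (\<lambda>x. det (A x))"
  unfolding det_def by (intro poly_in_sum poly_in_prod poly_in.mult poly_in.const assms)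

lemma poly_in_continuous_map:
  assumes "poly_in X f" "\<And>g. g \<in> X \<Longrightarrow> continuous_map T euclideanreal g"
  shows "continuous_map T euclideanreal f"
  using assms by (induction rule: poly_in.induct) (auto intro: continuous_map_add continuous_map_real_mult)

lemma poly_in_compose_real_polynomial:
  assumes "poly_in X f" "\<And>g. g \<in> X \<Longrightarrow> real_polynomial_function (\<lambda>t. g (L t))"
  shows "real_polynomial_function (\<lambda>t. f (L t))"
  using assms by (induction rule: poly_in.induct) auto

lemma finite_zeros_real_polynomial_function:
  fixes f :: "real \<Rightarrow> real"
  assumes "real_polynomial_function f" "f t \<noteq> 0"
  shows "finite {t. f t = 0}"
proof -
  obtain a n where f: "f = (\<lambda>x. \<Sum>i\<le>n. a i * x ^ i)"
    using real_polynomial_function_imp_sum[OF assms(1)] by blast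
  then have "\<exists>i\<le>n. a i \<noteq> 0"
    using assms(2) by (metis (mono_tags, lifting) atMost_iff mult_zero_left sum.neutral)
  then show ?thesis
    using polyfun_finite_roots[of a n] by (simp add: f)
qed

text \<open>Complete the independent family at \<open>B0\<close> to a basis and let the family's
  rows move with \<open>B\<close>, the padding rows staying constant. The determinant is the
  polynomial \<open>Q\<close>.\<close>

lemma independence_certificate:
  fixes x :: "'i \<Rightarrow> 'b \<Rightarrow> real^'n"
  assumes inj: "inj_on (\<lambda>i. x i B0) I" and indep: "independent ((\<lambda>i. x i B0) ` I)"
    and poly: "\<And>i l. i \<in> I \<Longrightarrow> poly_in X (\<lambda>B. x i B $ l)"
  obtains Q where "poly_in X Q" "Q B0 \<noteq> 0"
    "\<And>B. Q B \<noteq> 0 \<Longrightarrow> inj_on (\<lambda>i. x i B) I \<and> independent ((\<lambda>i. x i B) ` I)"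
proof -
  let ?A = "(\<lambda>i. x i B0) ` I"
  obtain \<beta> where \<beta>: "det (completed_matrix \<beta> ?A (\<lambda>y. y)) \<noteq> 0"
    "\<And>u. det (completed_matrix \<beta> ?A u) \<noteq> 0 \<Longrightarrow> inj_on u ?A \<and> independent (u ` ?A)"
    using independent_completed_matrix[OF indep] by metis
  \<comment> \<open>The substitution sends the vector of index \<open>i\<close> at \<open>B0\<close>
    to the vector of the same index at \<open>B\<close>. Injectivity at \<open>B0\<close> makes the
    index recoverable, and at \<open>B0\<close> itself the substitution is the identity on the
    family.\<close>
  define u where "u B y = x (inv_into I (\<lambda>i. x i B0) y) B" for B y
  have u: "u B (x i B0) = x i B" if "i \<in> I" for i B
    using that by (simp add: u_def inv_into_f_f[OF inj])
  define Q where "Q B = det (completed_matrix \<beta> ?A (u B))" for B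
  have "poly_in X Q"
    unfolding Q_def
  proof (rule poly_in_det)
    fix i j
    show "poly_in X (\<lambda>B. completed_matrix \<beta> ?A (u B) $ i $ j)"
    proof (cases "\<beta> i \<in> ?A")
      case True
      then obtain a where "a \<in> I" "\<beta> i = x a B0" by blast
      then show ?thesis
        using True poly[of a j] by (simp add: completed_matrix_def u)
    next
      case False
      then show ?thesis
        by (simp add: completed_matrix_def poly_in.const)
    qed
  qed
  moreover have "completed_matrix \<beta> ?A (u B0) = completed_matrix \<beta> ?A (\<lambda>y. y)"
    unfolding completed_matrix_def by (intro arg_cong[of _ _ vec_lambda] ext if_cong) (auto simp: u)
  then have "Q B0 \<noteq> 0"
    using \<beta>(1) by (simp add: Q_def)
  moreover have "inj_on (\<lambda>i. x i B) I \<and> independent ((\<lambda>i. x i B) ` I)" if "Q B \<noteq> 0" for B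
  proof -
    have *: "inj_on (u B) ?A" "independent (u B ` ?A)"
      using \<beta>(2) that by (auto simp: Q_def)
    have "inj_on (u B \<circ> (\<lambda>i. x i B0)) I"
      using inj *(1) by (rule comp_inj_on)
    then have "inj_on (\<lambda>i. x i B) I"
      using u by (simp add: inj_on_def)
    moreover have "u B ` ?A = (\<lambda>i. x i B) ` I"
      using u by (auto simp: image_image)
    ultimately show ?thesis
      using *(2) by simp
  qed
  ultimately show thesis by (rule that)
qed

section \<open>Openness of frames and of the span map\<close>

abbreviation frame_space :: "nat \<Rightarrow> (nat \<Rightarrow> 'a::euclidean_space) topology" where
  "frame_space r \<equiv> product_topology (\<lambda>_. euclidean) {..<r}"

lemma continuous_map_coordinate:
  assumes "j < r"
  shows "continuous_map (frame_space r) euclideanreal (\<lambda>B :: nat \<Rightarrow> real^'n. B j $ l)"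
proof -
  have "continuous_map (frame_space r) euclideanreal ((\<lambda>v. v $ l) \<circ> (\<lambda>B :: nat \<Rightarrow> real^'n. B j))"
  proof (rule continuous_map_compose)
    show "continuous_map (frame_space r) euclidean (\<lambda>B :: nat \<Rightarrow> real^'n. B j)"
      using assms by (intro continuous_map_product_projection) simp
    show "continuous_map euclidean euclideanreal (\<lambda>v :: real^'n. v $ l)"
      by (auto intro: continuous_on_component)
  qed
  then show ?thesis by (simp add: comp_def)
qed

lemma openin_nonzero_set:
  assumes "continuous_map T euclideanreal Q"
  shows "openin T {B \<in> topspace T. Q B \<noteq> 0}"
  using openin_continuous_map_preimage[OF assms, of "- {0}"] by (simp add: open_Compl)

text \<open>Around each frame, the nonvanishing set of its independence certificate is an open set
  of tuples consisting of frames only.\<close>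

lemma openin_frames:
  "openin (frame_space r) (topspace (frames r :: (nat \<Rightarrow> real^'d) topology))"
proof (subst openin_subopen, intro ballI)
  fix B :: "nat \<Rightarrow> real^'d" assume B: "B \<in> topspace (frames r)"
  let ?X = "{\<lambda>C :: nat \<Rightarrow> real^'d. C j $ l | j l. j < r}"
  obtain Q where Q: "poly_in ?X Q" "Q B \<noteq> 0"
    "\<And>C. Q C \<noteq> 0 \<Longrightarrow> inj_on C {..<r} \<and> independent (C ` {..<r})"
    by (rule independence_certificate[of "\<lambda>j C. C j" B "{..<r}" ?X])
      (use B in \<open>auto simp: topspace_frames intro: poly_in.gen\<close>)
  have "continuous_map (frame_space r) euclideanreal Q"
    using Q(1) by (rule poly_in_continuous_map) (auto intro: continuous_map_coordinate)
  then have "openin (frame_space r) {C \<in> topspace (frame_space r). Q C \<noteq> 0}"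
    by (rule openin_nonzero_set)
  moreover have "B \<in> {C \<in> topspace (frame_space r). Q C \<noteq> 0}"
    using B Q by (simp add: topspace_frames PiE_def)
  moreover have "{C \<in> topspace (frame_space r). Q C \<noteq> 0} \<subseteq> topspace (frames r)"
    using Q(3) by (auto simp: topspace_frames PiE_def)
  ultimately show "\<exists>T. openin (frame_space r) T \<and> B \<in> T \<and> T \<subseteq> topspace (frames r)"
    by blast
qed

lemma frames_eq_subtopology:
  "frames r = subtopology (frame_space r) (topspace (frames r :: (nat \<Rightarrow> 'a::euclidean_space) topology))"
  unfolding frames_def by (metis subtopology_subtopology subtopology_topspace topspace_subtopology
      subtopology_restrict)

lemma openin_frames_iff:
  "openin (frames r) (W :: (nat \<Rightarrow> real^'d) set) \<longleftrightarrow> openin (frame_space r) W \<and> W \<subseteq> topspace (frames r)"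
  by (subst frames_eq_subtopology) (rule openin_open_subtopology[OF openin_frames])

text \<open>By the quotient topology it suffices that the saturation of an open \<open>W\<close> is
  open. If \<open>B\<close> has the same span as some \<open>B'\<close> in \<open>W\<close>, the
  fixed change of basis from \<open>B\<close> to \<open>B'\<close> sends all frames near
  \<open>B\<close> into \<open>W\<close> without changing their spans.\<close>

lemma open_map_span_frames:
  "open_map (frames r) (grassmannian r :: (real^'d) set topology) (\<lambda>B. span (B ` {..<r}))"
  unfolding open_map_def
proof (intro allI impI)
  fix W :: "(nat \<Rightarrow> real^'d) set" assume W: "openin (frames r) W"
  let ?q = "\<lambda>B :: nat \<Rightarrow> real^'d. span (B ` {..<r})"
  have frame_dim: "dim (B ` {..<r}) = r" if "B \<in> topspace (frames r)" for B :: "nat \<Rightarrow> real^'d"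
    using that by (simp add: topspace_frames dim_eq_card_independent card_image)
  have "W \<subseteq> topspace (frames r)"
    using W openin_subset by blast
  then have sub: "?q ` W \<subseteq> {U. subspace U \<and> dim U = r}"
    using frame_dim by auto
  have "openin (frames r) {B \<in> topspace (frames r). ?q B \<in> ?q ` W}"
  proof (subst openin_subopen, intro ballI)
    fix B assume "B \<in> {B \<in> topspace (frames r). ?q B \<in> ?q ` W}"
    then obtain B' where B: "B \<in> topspace (frames r)" "B' \<in> W" "?q B = ?q B'"
      by blast
    have B'_ext: "B' \<in> extensional {..<r}"
      using B(2) \<open>W \<subseteq> topspace (frames r)\<close> by (auto simp: topspace_frames)
    have "\<exists>c. B' j = (\<Sum>l<r. c l *\<^sub>R B l)" if "j < r" for j
    proof -
      have "B' j \<in> ?q B"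
        using B(3) that by (auto intro: span_base)
      then show ?thesis
        using mem_span_image_finite[of "{..<r}"] by (metis finite_lessThan)
    qed
    then obtain c where c: "\<And>j. j < r \<Longrightarrow> B' j = (\<Sum>l<r. c j l *\<^sub>R B l)"
      by metis
    \<comment> \<open>The coefficients expressing \<open>B'\<close> through \<open>B\<close>,
      applied to a variable tuple \<open>C\<close>; restricting to \<open>{..<r}\<close> keeps the
      result extensional.\<close>
    define \<phi> where "\<phi> C = (\<lambda>j\<in>{..<r}. \<Sum>l<r. c j l *\<^sub>R C l)" for C :: "nat \<Rightarrow> real^'d"
    have \<phi>B: "\<phi> B = B'"
      using c B'_ext by (auto simp: \<phi>_def extensional_def)
    have "continuous_map (frame_space r) euclidean (\<lambda>C. \<phi> C j)" if "j \<in> {..<r}" for j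
    proof -
      have "continuous_map (frame_space r) euclidean ((*\<^sub>R) a \<circ> (\<lambda>C :: nat \<Rightarrow> real^'d. C l))"
        if "l < r" for l and a :: real
        by (rule continuous_map_compose[OF continuous_map_product_projection])
          (use that in \<open>auto intro: continuous_intros\<close>)
      then show ?thesis
        using that by (auto simp: \<phi>_def comp_def intro!: continuous_map_sum)
    qed
    then have "continuous_map (frame_space r) (frame_space r) \<phi>"
      by (auto simp: continuous_map_componentwise \<phi>_def)
    then have "openin (frame_space r) {C \<in> topspace (frames r). \<phi> C \<in> W}"
      using W openin_frames
      by (intro openin_continuous_map_preimage_gen) (auto simp: openin_frames_iff)
    then have "openin (frames r) {C \<in> topspace (frames r). \<phi> C \<in> W}"
      by (auto simp: openin_frames_iff)
    moreover have "B \<in> {C \<in> topspace (frames r). \<phi> C \<in> W}"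
      using B \<phi>B by simp
    \<comment> \<open>Membership in \<open>W\<close> makes \<open>\<phi> C\<close> a frame, so its
      span has dimension \<open>r\<close> and fills the span of \<open>C\<close> that contains
      it.\<close>
    moreover have "?q C = ?q (\<phi> C)" if C: "C \<in> topspace (frames r)" "\<phi> C \<in> W" for C
    proof -
      have "\<phi> C ` {..<r} \<subseteq> ?q C"
        by (force simp: \<phi>_def intro: span_sum span_scale span_base)
      then have "?q (\<phi> C) \<subseteq> ?q C"
        by (simp add: span_minimal)
      moreover have "\<phi> C \<in> topspace (frames r)"
        using C(2) \<open>W \<subseteq> topspace (frames r)\<close> by blast
      ultimately show ?thesis
        using frame_dim C(1) by (metis dim_span order_refl subspace_dim_equal subspace_span)
    qed
    ultimately show "\<exists>T. openin (frames r) T \<and> B \<in> T \<and>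
        T \<subseteq> {B \<in> topspace (frames r). ?q B \<in> ?q ` W}"
      by (intro exI[of _ "{C \<in> topspace (frames r). \<phi> C \<in> W}"]) auto
  qed
  with sub show "openin (grassmannian r) (?q ` W)"
    by (simp add: openin_grassmannian)
qed


section \<open>Generic rank\<close>

definition frame_union :: "nat \<Rightarrow> nat \<Rightarrow> (nat \<Rightarrow> nat \<Rightarrow> 'a::real_vector) \<Rightarrow> 'a set" where
  "frame_union K r B = (\<Union>i<K. span (B i ` {..<r}))"

definition coordinates :: "nat \<Rightarrow> nat \<Rightarrow> ((nat \<Rightarrow> nat \<Rightarrow> real^'d) \<Rightarrow> real) set" where
  "coordinates K r = {\<lambda>B. B i j $ l | i j l. i < K \<and> j < r}"

text \<open>Choose independent masked tensors at \<open>B0\<close> realising the rank, and write the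
  vector behind each as a combination of frame vectors. With the coefficients held fixed, the
  tensors become polynomial in the frame entries and remain masked tensors of the moved union;
  keeping them independent keeps the rank at least as large.\<close>

lemma rank_certificate:
  fixes B0 :: "nat \<Rightarrow> nat \<Rightarrow> real^'d::{finite,linorder}" and I :: "'d set"
  obtains Q where "poly_in (coordinates K r) Q" "Q B0 \<noteq> 0"
    "\<And>B. Q B \<noteq> 0 \<Longrightarrow>
      dim (masked_tensors I (frame_union K r B0) ::
        (real^('d::{finite,linorder}, 'p::{finite,linorder}) sym_idx) set) \<le>
      dim (masked_tensors I (frame_union K r B) ::
        (real^('d::{finite,linorder}, 'p::{finite,linorder}) sym_idx) set)"
proof -
  let ?T = "\<lambda>B. masked_tensors I (frame_union K r B) ::
    (real^('d::{finite,linorder}, 'p::{finite,linorder}) sym_idx) set"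
  obtain A where A: "A \<subseteq> ?T B0" "independent A" "card A = dim (?T B0)"
    using basis_exists[of "?T B0"] by metis
  have "\<exists>i c. i < K \<and> a = tensor_power (coord_mask I (\<Sum>j<r. c j *\<^sub>R B0 i j))" if a: "a \<in> A" for a
  proof -
    obtain i y where i: "i < K" "y \<in> span (B0 i ` {..<r})" "a = tensor_power (coord_mask I y)"
      using subsetD[OF A(1) a] by (auto simp: masked_tensors_def frame_union_def)
    then show ?thesis
      using mem_span_image_finite[of "{..<r}" y "B0 i"] by (metis finite_lessThan)
  qed
  then obtain i c where ic: "\<And>a. a \<in> A \<Longrightarrow>
      i a < K \<and> a = tensor_power (coord_mask I (\<Sum>j<r. c a j *\<^sub>R B0 (i a) j))"
    by metis
  define x where "x a B = (tensor_power (coord_mask I (\<Sum>j<r. c a j *\<^sub>R B (i a) j)) ::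
    real^('d::{finite,linorder}, 'p::{finite,linorder}) sym_idx)" for a B
  have x0: "x a B0 = a" if "a \<in> A" for a
    using ic[OF that] by (simp add: x_def)
  obtain Q where Q: "poly_in (coordinates K r) Q" "Q B0 \<noteq> 0"
    "\<And>B. Q B \<noteq> 0 \<Longrightarrow> inj_on (\<lambda>a. x a B) A \<and> independent ((\<lambda>a. x a B) ` A)"
  proof (rule independence_certificate[of x B0 A "coordinates K r"])
    show "inj_on (\<lambda>a. x a B0) A" "independent ((\<lambda>a. x a B0) ` A)"
      using A(2) by (auto simp: inj_on_def x0 cong: image_cong)
    fix a l assume "a \<in> A"
    then have "poly_in (coordinates K r) (\<lambda>B. \<Sum>j<r. c a j * B (i a) j $ n)" for n
      using ic by (intro poly_in_sum poly_in.mult poly_in.const poly_in.gen) (auto simp: coordinates_def)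
    then have "poly_in (coordinates K r) (\<lambda>B. coord_mask I (\<Sum>j<r. c a j *\<^sub>R B (i a) j) $ n)" for n
      by (cases "n \<in> I") (simp_all add: coord_mask_def poly_in.const)
    then show "poly_in (coordinates K r) (\<lambda>B. x a B $ l)"
      by (simp add: x_def tensor_power_def poly_in_prod)
  qed blast
  have "dim (?T B0) \<le> dim (?T B)" if "Q B \<noteq> 0" for B
  proof -
    have "(\<lambda>a. x a B) ` A \<subseteq> ?T B"
    proof
      fix v assume "v \<in> (\<lambda>a. x a B) ` A"
      then obtain a where "a \<in> A" "v = x a B" by blast
      moreover from this have "(\<Sum>j<r. c a j *\<^sub>R B (i a) j) \<in> frame_union K r B"
        using ic by (force simp: frame_union_def intro: bexI[of _ "i a"] span_sum span_scale span_base)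
      ultimately show "v \<in> ?T B"
        by (auto simp: x_def masked_tensors_def)
    qed
    then have "card ((\<lambda>a. x a B) ` A) \<le> dim (?T B)"
      using Q(3)[OF that] independent_card_le_dim by blast
    then show ?thesis
      using Q(3)[OF that] A(3) by (simp add: card_image)
  qed
  with Q show thesis using that by blast
qed

section \<open>Open dense sets of frame configurations\<close>

abbreviation config_space :: "nat \<Rightarrow> nat \<Rightarrow> (nat \<Rightarrow> nat \<Rightarrow> 'a::euclidean_space) topology" where
  "config_space K r \<equiv> product_topology (\<lambda>_. frame_space r) {..<K}"

abbreviation frame_configs :: "nat \<Rightarrow> nat \<Rightarrow> (nat \<Rightarrow> nat \<Rightarrow> 'a::euclidean_space) topology" where
  "frame_configs K r \<equiv> product_topology (\<lambda>_. frames r) {..<K}"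

text \<open>Moves openness into the space of all tuples of tuples, which contains the whole line
  through two configurations even where independence fails on it.\<close>

lemma openin_frame_configs_iff:
  "openin (frame_configs K r) (W :: (nat \<Rightarrow> nat \<Rightarrow> real^'d) set) \<longleftrightarrow>
    openin (config_space K r) W \<and> W \<subseteq> topspace (frame_configs K r)"
proof -
  let ?F = "topspace (frames r :: (nat \<Rightarrow> real^'d) topology)"
  have "frame_configs K r = product_topology (\<lambda>_. subtopology (frame_space r) ?F) {..<K}"
    using frames_eq_subtopology by metis
  also have "\<dots> = subtopology (config_space K r) (\<Pi>\<^sub>E i\<in>{..<K}. ?F)"
    by (rule subtopology_product_topology[symmetric])
  finally have "frame_configs K r = subtopology (config_space K r) (\<Pi>\<^sub>E i\<in>{..<K}. ?F)" .
  moreover have "openin (config_space K r) (\<Pi>\<^sub>E i\<in>{..<K}. ?F)"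
    by (simp add: openin_PiE openin_frames)
  ultimately have "openin (frame_configs K r) W \<longleftrightarrow> openin (config_space K r) W \<and> W \<subseteq> (\<Pi>\<^sub>E i\<in>{..<K}. ?F)"
    by (simp only: openin_open_subtopology)
  then show ?thesis
    by (simp only: topspace_product_topology)
qed

lemma openin_poly_nonzero:
  fixes Q :: "(nat \<Rightarrow> nat \<Rightarrow> real^'d) \<Rightarrow> real"
  assumes "poly_in (coordinates K r) Q"
  shows "openin (frame_configs K r) {B \<in> topspace (frame_configs K r). Q B \<noteq> 0}"
proof -
  have "continuous_map (frame_configs K r) euclideanreal Q"
    using assms
  proof (rule poly_in_continuous_map)
    fix g :: "(nat \<Rightarrow> nat \<Rightarrow> real^'d) \<Rightarrow> real" assume "g \<in> coordinates K r"
    then obtain i j l where g: "g = (\<lambda>B. B i j $ l)" "i < K" "j < r"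
      by (auto simp: coordinates_def)
    have "continuous_map (frame_configs K r) euclideanreal ((\<lambda>B. B j $ l) \<circ> (\<lambda>B :: nat \<Rightarrow> nat \<Rightarrow> real^'d. B i))"
    proof (rule continuous_map_compose)
      show "continuous_map (frame_configs K r) (frames r) (\<lambda>B :: nat \<Rightarrow> nat \<Rightarrow> real^'d. B i)"
        using g by (intro continuous_map_product_projection) simp
      show "continuous_map (frames r) euclideanreal (\<lambda>B :: nat \<Rightarrow> real^'d. B j $ l)"
        by (subst frames_eq_subtopology)
          (rule continuous_map_from_subtopology[OF continuous_map_coordinate[OF g(3)]])
    qed
    then show "continuous_map (frame_configs K r) euclideanreal g"
      by (simp add: g(1) comp_def)
  qed
  then show ?thesis
    by (rule openin_nonzero_set)
qed

text \<open>
  Restricted to the line joining two configurations, a polynomial in the frame entries has only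
  finitely many zeros unless it vanishes at both ends.
\<close>

lemma dense_poly_nonzero:
  fixes Q :: "(nat \<Rightarrow> nat \<Rightarrow> real^'d) \<Rightarrow> real"
  assumes Q: "poly_in (coordinates K r) Q" and B1: "B1 \<in> topspace (frame_configs K r)" "Q B1 \<noteq> 0"
    and W: "openin (frame_configs K r) W" "W \<noteq> {}"
  shows "\<exists>B\<in>W. Q B \<noteq> 0"
proof -
  obtain B0 where B0: "B0 \<in> W" using W by blast
  have ext: "(\<lambda>i\<in>{..<K}. \<lambda>j\<in>{..<r}. B i j) = B" if "B \<in> topspace (frame_configs K r)"
    for B :: "nat \<Rightarrow> nat \<Rightarrow> real^'d"
  proof
    fix i
    show "(\<lambda>i\<in>{..<K}. \<lambda>j\<in>{..<r}. B i j) i = B i"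
      using that by (cases "i < K") (auto simp: topspace_frames PiE_def extensional_def Pi_def)
  qed
  \<comment> \<open>The line from \<open>B0\<close> at 0 to \<open>B1\<close> at 1. It may leave the
    frames, so its continuity is stated into \<open>config_space\<close>; the open set of parameters
    landing in \<open>W\<close> contains 0 and is therefore infinite.\<close>
  define L where "L t = (\<lambda>i\<in>{..<K}. \<lambda>j\<in>{..<r}. B0 i j + t *\<^sub>R (B1 i j - B0 i j))" for t :: real
  have "B0 \<in> topspace (frame_configs K r)"
    using B0 W(1) openin_subset by blast
  then have L0: "L 0 = B0"
    using ext by (simp add: L_def)
  have L1: "L 1 = B1"
    using ext[OF B1(1)] by (simp add: L_def)
  have "continuous_map euclidean (config_space K r) L"
  proof (subst continuous_map_componentwise, intro conjI ballI)
    fix i assume "i \<in> {..<K}"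
    then show "continuous_map euclidean (frame_space r) (\<lambda>t. L t i)"
      by (auto simp: continuous_map_componentwise L_def intro!: continuous_intros)
  qed (auto simp: L_def)
  moreover have "openin (config_space K r) W"
    using W(1) by (simp add: openin_frame_configs_iff)
  ultimately have "open {t. L t \<in> W}"
    using openin_continuous_map_preimage by fastforce
  moreover have "0 \<in> {t. L t \<in> W}"
    using B0 L0 by simp
  ultimately have "infinite {t. L t \<in> W}"
    using finite_imp_not_open by blast
  moreover have "real_polynomial_function (\<lambda>t. Q (L t))"
    using Q
  proof (rule poly_in_compose_real_polynomial)
    fix g :: "(nat \<Rightarrow> nat \<Rightarrow> real^'d) \<Rightarrow> real" assume "g \<in> coordinates K r"
    then obtain i j l where g: "g = (\<lambda>B. B i j $ l)" "i < K" "j < r"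
      by (auto simp: coordinates_def)
    have "real_polynomial_function (\<lambda>t::real. B0 i j $ l + t * (B1 i j $ l - B0 i j $ l))"
      by (intro real_polynomial_function.intros bounded_linear_ident)
    then show "real_polynomial_function (\<lambda>t. g (L t))"
      using g by (simp add: L_def)
  qed
  then have "finite {t. Q (L t) = 0}"
    by (rule finite_zeros_real_polynomial_function[of _ 1]) (simp add: L1 B1)
  ultimately have "\<not> {t. L t \<in> W} \<subseteq> {t. Q (L t) = 0}"
    using finite_subset by blast
  then show ?thesis by blast
qed

text \<open>Handle the polynomials one at a time, each time shrinking \<open>W\<close> to the still
  nonempty open subset where the current one does not vanish.\<close>

lemma dense_polys_nonzero:
  fixes Q :: "'i \<Rightarrow> (nat \<Rightarrow> nat \<Rightarrow> real^'d) \<Rightarrow> real"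
  assumes "finite J"
    and Q: "\<And>i. i \<in> J \<Longrightarrow> poly_in (coordinates K r) (Q i)"
      "\<And>i. i \<in> J \<Longrightarrow> \<exists>B\<in>topspace (frame_configs K r). Q i B \<noteq> 0"
    and W: "openin (frame_configs K r) W" "W \<noteq> {}"
  shows "\<exists>B\<in>W. \<forall>i\<in>J. Q i B \<noteq> 0"
  using assms
proof (induction J arbitrary: W rule: finite_induct)
  case empty
  then show ?case by blast
next
  case (insert i J)
  let ?W = "W \<inter> {B \<in> topspace (frame_configs K r). Q i B \<noteq> 0}"
  have "openin (frame_configs K r) ?W"
    using insert.prems by (intro openin_Int openin_poly_nonzero) auto
  moreover have "\<exists>B\<in>W. Q i B \<noteq> 0"
    using insert.prems by (metis dense_poly_nonzero insertI1)
  then have "?W \<noteq> {}"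
    using openin_subset[OF insert.prems(3)] by blast
  ultimately have "\<exists>B\<in>?W. \<forall>i\<in>J. Q i B \<noteq> 0"
    using insert.prems by (intro insert.IH) auto
  then show ?case by blast
qed

text \<open>Open density descends from frames to the Grassmannians through the factorwise span map:
  openness because each factor is an open map, density because preimages of nonempty open sets are
  nonempty and open.\<close>

lemma generic_union_frame_configs:
  fixes P :: "(real^'d) set \<Rightarrow> bool"
  assumes "openin (frame_configs K r) H" "\<And>W. openin (frame_configs K r) W \<Longrightarrow> W \<noteq> {} \<Longrightarrow> H \<inter> W \<noteq> {}"
    and "\<And>B. B \<in> H \<Longrightarrow> P (frame_union K r B)"
  shows "generic_union K r P"
proof -
  let ?X = "product_topology (\<lambda>_. grassmannian r :: (real^'d) set topology) {..<K}"
  let ?q = "\<lambda>B :: nat \<Rightarrow> real^'d. span (B ` {..<r})"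
  define G where "G = (\<lambda>B. \<lambda>i\<in>{..<K}. ?q (B i)) ` H"
  have H: "H \<subseteq> topspace (frame_configs K r)"
    using assms(1) by (rule openin_subset)
  have q_top: "?q B \<in> topspace (grassmannian r)" if "B \<in> topspace (frames r)" for B
    using that by (auto simp: topspace_frames topspace_grassmannian dim_eq_card_independent card_image)
  have "openin ?X G"
    unfolding openin_product_topology_alt
  proof
    fix U assume "U \<in> G"
    then obtain B where B: "B \<in> H" "U = (\<lambda>i\<in>{..<K}. ?q (B i))"
      by (auto simp: G_def)
    obtain W where W: "\<forall>i\<in>{..<K}. openin (frames r) (W i)" "B \<in> Pi\<^sub>E {..<K} W" "Pi\<^sub>E {..<K} W \<subseteq> H"
      using assms(1) B(1) unfolding openin_product_topology_alt by metis
    \<comment> \<open>Frames representing the factors can be chosen independently of each other, so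
      the image of a box inside \<open>H\<close> is the full box of images.\<close>
    have "Pi\<^sub>E {..<K} (\<lambda>i. ?q ` W i) \<subseteq> G"
    proof
      fix U' assume U': "U' \<in> Pi\<^sub>E {..<K} (\<lambda>i. ?q ` W i)"
      then have "\<exists>C. C \<in> W i \<and> U' i = ?q C" if "i < K" for i
        using that by (auto simp: PiE_def Pi_def)
      then obtain C where C: "\<And>i. i < K \<Longrightarrow> C i \<in> W i \<and> U' i = ?q (C i)"
        by metis
      have "restrict C {..<K} \<in> H"
        using C W(3) by (auto intro!: subsetD[OF W(3)])
      moreover have "U' = (\<lambda>i\<in>{..<K}. ?q (restrict C {..<K} i))"
        using C U' by (auto simp: fun_eq_iff PiE_def extensional_def)
      ultimately show "U' \<in> G"
        unfolding G_def by blast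
    qed
    moreover have "U \<in> Pi\<^sub>E {..<K} (\<lambda>i. ?q ` W i)"
      using B(2) W(2) by auto
    moreover have "\<forall>i\<in>{..<K}. openin (grassmannian r) (?q ` W i)"
      using W(1) open_map_span_frames unfolding open_map_def by blast
    ultimately show "\<exists>V. finite {i \<in> {..<K}. V i \<noteq> topspace (grassmannian r)} \<and>
        (\<forall>i\<in>{..<K}. openin (grassmannian r) (V i)) \<and> U \<in> Pi\<^sub>E {..<K} V \<and> Pi\<^sub>E {..<K} V \<subseteq> G"
      by (intro exI[of _ "\<lambda>i. ?q ` W i"]) auto
  qed
  moreover have "?X closure_of G = topspace ?X"
    unfolding dense_intersects_open
  proof (intro allI impI)
    fix T assume T: "openin ?X T \<and> T \<noteq> {}"
    let ?W = "{B \<in> topspace (frame_configs K r). (\<lambda>i\<in>{..<K}. ?q (B i)) \<in> T}"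
    have "continuous_map (frame_configs K r) (grassmannian r) (\<lambda>B. ?q (B i))" if "i \<in> {..<K}" for i
      using continuous_map_compose[OF continuous_map_product_projection[OF that]
          quotient_imp_continuous_map[OF quotient_map_grassmannian]]
      by (simp add: comp_def)
    then have "continuous_map (frame_configs K r) ?X (\<lambda>B. \<lambda>i\<in>{..<K}. ?q (B i))"
      by (auto simp: continuous_map_componentwise)
    then have "openin (frame_configs K r) ?W"
      using T by (intro openin_continuous_map_preimage) auto
    moreover have "?W \<noteq> {}"
    proof -
      obtain U where U: "U \<in> T" using T by blast
      then have Utop: "U \<in> topspace ?X"
        using T openin_subset by blast
      have "\<exists>C \<in> topspace (frames r). U i = ?q C" if "i < K" for i
      proof -
        have "U i \<in> topspace (grassmannian r)"
          using Utop that by auto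
        then show ?thesis
          using quotient_imp_surjective_map[OF quotient_map_grassmannian] by blast
      qed
      then obtain C where C: "\<And>i. i < K \<Longrightarrow> C i \<in> topspace (frames r) \<and> U i = ?q (C i)"
        by metis
      have "(\<lambda>i\<in>{..<K}. ?q (restrict C {..<K} i)) = U"
        using C Utop by (auto simp: fun_eq_iff PiE_def extensional_def)
      then have "restrict C {..<K} \<in> ?W"
        using C U by auto
      then show ?thesis by blast
    qed
    ultimately have "H \<inter> ?W \<noteq> {}"
      by (rule assms(2))
    then show "G \<inter> T \<noteq> {}"
      by (auto simp: G_def)
  qed
  moreover have "P (\<Union>i<K. U i)" if "U \<in> G" for U
    using that assms(3) by (auto simp: G_def frame_union_def)
  ultimately show ?thesis
    unfolding generic_union_def Let_def by blast
qed

text \<open>The good set \<open>H\<close> consists of the configurations at which every mask attains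
  its maximal rank simultaneously. There are finitely many masks, so the certificates make
  \<open>H\<close> open and dense.\<close>

lemma generic_rank_constant:
  fixes r :: nat
  assumes "r \<le> CARD('d::{finite,linorder})"
    and P: "\<And>V. (\<exists>N. \<forall>I :: 'd set. card I = m \<longrightarrow>
      dim (masked_tensors I V :: (real^('d, 'p::{finite,linorder}) sym_idx) set) = N) \<Longrightarrow> P V"
  shows "generic_union K r P"
proof -
  let ?F = "topspace (frame_configs K r) :: (nat \<Rightarrow> nat \<Rightarrow> real^'d::{finite,linorder}) set"
  let ?f = "\<lambda>I B. dim (masked_tensors I (frame_union K r B) ::
    (real^('d::{finite,linorder}, 'p::{finite,linorder}) sym_idx) set)"
  have fin: "finite (?f I ` ?F)" for I
    by (rule finite_subset[of _ "{..CARD(('d, 'p) sym_idx)}"])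
      (use dim_subset_UNIV_cart in auto)
  \<comment> \<open>Here \<open>r \<le> CARD('d)\<close> provides a frame, so that the maxima below
    range over nonempty sets.\<close>
  have "\<exists>U :: (real^'d::{finite,linorder}) set. subspace U \<and> dim U = r"
    using choose_subspace_of_subspace[of r "UNIV :: (real^'d::{finite,linorder}) set"] assms(1) by auto
  then have "topspace (grassmannian r :: (real^'d::{finite,linorder}) set topology) \<noteq> {}"
    by (auto simp: topspace_grassmannian)
  then have "topspace (frames r :: (nat \<Rightarrow> real^'d::{finite,linorder}) topology) \<noteq> {}"
    using quotient_imp_surjective_map[OF quotient_map_grassmannian[where 'a = "real^'d::{finite,linorder}"], of r]
    by blast
  then have ne: "?F \<noteq> {}"
    by (auto simp: PiE_eq_empty_iff)
  define N where "N I = Max (?f I ` ?F)" for I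
  have N_ge: "?f I B \<le> N I" if "B \<in> ?F" for I B
    unfolding N_def using fin that by (intro Max_ge) auto
  have N_att: "\<exists>B\<in>?F. ?f I B = N I" for I
  proof -
    have "N I \<in> ?f I ` ?F"
      unfolding N_def using fin ne by (intro Max_in) auto
    then show ?thesis by auto
  qed
  \<comment> \<open>Take a configuration maximising the rank for \<open>J\<close> and move its frame
    vectors by the injective \<open>g\<close>; the new configuration \<open>C\<close> has rank at
    least \<open>N J\<close> for the mask \<open>I\<close>. Exchanging \<open>I\<close> and
    \<open>J\<close> gives equality.\<close>
  have N_le: "N J \<le> N I" if IJ: "card I = card J" for I J
  proof -
    obtain B where B: "B \<in> ?F" "?f J B = N J"
      using N_att by blast
    obtain g :: "real^'d::{finite,linorder} \<Rightarrow> real^'d::{finite,linorder}" where g: "linear g" "inj g"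
      "\<And>V. dim (masked_tensors J V :: (real^('d, 'p) sym_idx) set) \<le>
         dim (masked_tensors I (g ` V) :: (real^('d, 'p) sym_idx) set)"
      using masked_tensors_permute[OF IJ, where 'p = 'p] by blast
    define C where "C = (\<lambda>i\<in>{..<K}. \<lambda>j\<in>{..<r}. g (B i j))"
    have C_img: "C i ` {..<r} = g ` B i ` {..<r}" if "i < K" for i
      using that by (auto simp: C_def)
    have "C \<in> ?F"
    proof -
      have "C i \<in> topspace (frames r)" if "i < K" for i
      proof -
        have B_i: "inj_on (B i) {..<r}" "independent (B i ` {..<r})"
          using B(1) that by (auto simp: topspace_frames PiE_def Pi_def)
        have "inj_on (C i) {..<r}"
          using that B_i(1) g(2) by (auto simp: C_def inj_on_def dest: injD)
        moreover have "independent (C i ` {..<r})"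
          unfolding C_img[OF that] using g(1) B_i(2) inj_on_subset[OF g(2)]
          by (intro linear_independent_injective_image) auto
        ultimately show ?thesis
          using that by (auto simp: topspace_frames C_def)
      qed
      then show ?thesis
        by (auto simp: C_def)
    qed
    moreover have "frame_union K r C = g ` frame_union K r B"
      by (simp add: frame_union_def C_img image_UN linear_span_image[OF g(1)])
    ultimately show ?thesis
      using g(3)[of "frame_union K r B"] N_ge[of C I] B(2) by simp
  qed
  define H where "H = {B \<in> ?F. \<forall>I. ?f I B = N I}"
  \<comment> \<open>Since \<open>N I\<close> is a maximum, attaining it is a lower bound on the
    rank, which is the form the certificates deliver.\<close>
  have H_alt: "B \<in> H \<longleftrightarrow> B \<in> ?F \<and> (\<forall>I. N I \<le> ?f I B)" for B
    using N_ge by (auto simp: H_def intro: antisym)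
  show ?thesis
  proof (rule generic_union_frame_configs)
    show "openin (frame_configs K r) H"
    proof (subst openin_subopen, intro ballI)
      fix B assume B: "B \<in> H"
      have "\<exists>Q. poly_in (coordinates K r) Q \<and> Q B \<noteq> 0 \<and> (\<forall>C. Q C \<noteq> 0 \<longrightarrow> ?f I B \<le> ?f I C)" for I
        using rank_certificate[of K r B I, where 'p = 'p] by metis
      then obtain Q where Q: "\<And>I. poly_in (coordinates K r) (Q I)" "\<And>I. Q I B \<noteq> 0"
        "\<And>I C. Q I C \<noteq> 0 \<Longrightarrow> ?f I B \<le> ?f I C"
        by metis
      let ?T = "\<Inter>I\<in>UNIV. {C \<in> ?F. Q I C \<noteq> 0}"
      have "openin (frame_configs K r) ?T"
        by (intro openin_INT2 openin_poly_nonzero Q(1)) auto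
      moreover have "B \<in> ?T"
        using B Q(2) by (simp add: H_def)
      moreover have "?T \<subseteq> H"
        using B Q(3) unfolding H_alt subset_iff by (auto intro: order_trans)
      ultimately show "\<exists>T. openin (frame_configs K r) T \<and> B \<in> T \<and> T \<subseteq> H"
        by blast
    qed
  next
    fix W :: "(nat \<Rightarrow> nat \<Rightarrow> real^'d::{finite,linorder}) set"
    assume W: "openin (frame_configs K r) W" "W \<noteq> {}"
    have "\<exists>Q. poly_in (coordinates K r) Q \<and> (\<exists>B\<in>?F. Q B \<noteq> 0) \<and> (\<forall>C. Q C \<noteq> 0 \<longrightarrow> N I \<le> ?f I C)" for I
    proof -
      obtain B where B: "B \<in> ?F" "?f I B = N I"
        using N_att by blast
      then show ?thesis
        using rank_certificate[of K r B I, where 'p = 'p] by metis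
    qed
    then obtain Q where Q: "\<And>I. poly_in (coordinates K r) (Q I)" "\<And>I. \<exists>B\<in>?F. Q I B \<noteq> 0"
        "\<And>I C. Q I C \<noteq> 0 \<Longrightarrow> N I \<le> ?f I C"
      by metis
    \<comment> \<open>The certificates come from possibly different maximisers, one per mask;
      density finds a single point of \<open>W\<close> where none of them vanishes.\<close>
    have "\<exists>B\<in>W. \<forall>I\<in>UNIV. Q I B \<noteq> 0"
      using Q W by (intro dense_polys_nonzero) auto
    then obtain B where B: "B \<in> W" "\<And>I. Q I B \<noteq> 0" by blast
    then have "B \<in> H"
      using Q(3) openin_subset[OF W(1)] unfolding H_alt by blast
    then show "H \<inter> W \<noteq> {}"
      using B(1) by blast
  next
    fix B assume B: "B \<in> H"
    have "N I = N J" if "card I = m" "card J = m" for I J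
      using that N_le by (metis antisym)
    then have "\<exists>n. \<forall>I. card I = m \<longrightarrow> N I = n"
      by metis
    then show "P (frame_union K r B)"
      using B by (intro P) (simp add: H_def)
  qed
qed

section \<open>The inequality for generic unions\<close>

theorem corollary1:
  fixes K r m d p D M :: nat
  assumes "d = CARD('d::{finite,linorder})" and "p = CARD('p::{finite,linorder})"
    and "K \<ge> 1" and "r \<ge> 1" and "m \<ge> 1" and "r \<le> d" and "m \<le> d"
    and "D = (d + p - 1) choose p" and "M = (m + p - 1) choose p"
  shows "generic_union K r (\<lambda>V.
           let S = (tensorized_subspace V ::
                     (real ^ ('d::{finite,linorder}, 'p::{finite,linorder}) sym_idx) set);
               R = dim S
           in \<exists>R'. (\<forall>\<upsilon>\<in>tensorized_patterns m. dim (canonical_projection S \<upsilon>) = R') \<and> R' \<le> R \<and>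
                   (uniquely_identifiable S (tensorized_patterns m) \<longrightarrow>
                      int (d choose m) * (int M - int R') \<ge> int D - int R))"
proof (rule generic_rank_constant[where 'p = 'p and m = m])
  show "r \<le> CARD('d)"
    using assms by simp
  fix V :: "(real^'d::{finite,linorder}) set"
  assume "\<exists>N. \<forall>I. card I = m \<longrightarrow> dim (masked_tensors I V :: (real^('d, 'p) sym_idx) set) = N"
  then obtain N where N: "\<And>I. card I = m \<Longrightarrow> dim (masked_tensors I V :: (real^('d, 'p) sym_idx) set) = N"
    by blast
  define S where "S = (tensorized_subspace V :: (real^('d, 'p) sym_idx) set)"
  let ?Y = "tensorized_patterns m :: (real^('d, 'p) sym_idx) set"
  have Y: "\<exists>\<omega> :: real^'d::{finite,linorder}. \<upsilon> = tensor_power \<omega> \<and> (\<forall>i. \<omega> $ i \<in> {0, 1}) \<and> card {i. \<omega> $ i = 1} = m"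
    if "\<upsilon> \<in> ?Y" for \<upsilon>
    using that by (auto simp: tensorized_patterns_def)
  have dimS: "dim (canonical_projection S \<upsilon>) = N" if "\<upsilon> \<in> ?Y" for \<upsilon>
    using Y[OF that] by (auto simp: S_def canonical_projection_tensorized N)
  have ones: "card {k. \<upsilon> $ k = 1} = M" if "\<upsilon> \<in> ?Y" for \<upsilon>
    using Y[OF that] assms by (auto simp: card_ones_tensor_power)
  \<comment> \<open>A binary vector is determined by its set of ones, so the patterns are covered by
    an image of the \<open>m\<close>-element subsets.\<close>
  have "?Y \<subseteq> (\<lambda>I. tensor_power (\<chi> i. if i \<in> I then 1 else 0)) ` {I :: 'd set. I \<subseteq> UNIV \<and> card I = m}"
  proof
    fix \<upsilon> assume "\<upsilon> \<in> ?Y"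
    then obtain \<omega> :: "real^'d::{finite,linorder}"
      where \<omega>: "\<upsilon> = tensor_power \<omega>" "\<forall>i. \<omega> $ i \<in> {0, 1}" "card {i. \<omega> $ i = 1} = m"
      using Y by blast
    have "\<omega> = (\<chi> i. if i \<in> {i. \<omega> $ i = 1} then 1 else 0)"
      using \<omega>(2) by (auto simp: vec_eq_iff)
    then have "\<upsilon> = tensor_power (\<chi> i. if i \<in> {i. \<omega> $ i = 1} then 1 else 0)"
      using \<omega>(1) by simp
    then show "\<upsilon> \<in> (\<lambda>I. tensor_power (\<chi> i. if i \<in> I then 1 else 0)) ` {I :: 'd set. I \<subseteq> UNIV \<and> card I = m}"
      by (rule image_eqI) (simp add: \<omega>(3))
  qed
  then have finY: "finite ?Y" and "card ?Y \<le> card {I :: 'd set. I \<subseteq> UNIV \<and> card I = m}"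
    by (auto intro: finite_subset surj_card_le)
  then have cardY: "card ?Y \<le> d choose m"
    using assms(1) n_subsets[of "UNIV :: 'd set" m] by simp
  \<comment> \<open>As \<open>m \<le> d\<close>, some pattern exists. It ties \<open>N\<close> to an
    actual projection, which gives both \<open>N \<le> dim S\<close> and
    \<open>N \<le> M\<close>.\<close>
  obtain I where I: "I \<subseteq> (UNIV :: 'd set)" "card I = m"
    using assms(1,7) obtain_subset_with_card_n[of m "UNIV :: 'd set"] by auto
  define \<upsilon>0 where "\<upsilon>0 = (tensor_power (\<chi> i. if i \<in> I then 1 else 0) :: real^('d, 'p) sym_idx)"
  have "\<upsilon>0 \<in> ?Y"
    using I by (auto simp: \<upsilon>0_def tensorized_patterns_def intro!: exI[of _ "\<chi> i. if i \<in> I then 1 else 0"])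
  have "N \<le> dim S"
    using dim_image_le[OF linear_restrict_coords, of \<upsilon>0 S] dimS[OF \<open>\<upsilon>0 \<in> ?Y\<close>]
    by (simp add: canonical_projection_def)
  have "canonical_projection S \<upsilon>0 \<subseteq> {x. \<forall>k. k \<notin> {k. \<upsilon>0 $ k = 1} \<longrightarrow> x $ k = 0}"
    by (auto simp: canonical_projection_def restrict_coords_def)
  then have "dim (canonical_projection S \<upsilon>0) \<le> card {k. \<upsilon>0 $ k = 1}"
    unfolding dim_coordinate_subspace[symmetric] by (rule dim_subset)
  then have "N \<le> M"
    using dimS ones \<open>\<upsilon>0 \<in> ?Y\<close> by simp
  have D: "CARD(('d, 'p) sym_idx) = D"
    using card_sym_idx_range[of "UNIV :: 'd set", where 'p = 'p] assms by simp
  have "int D - int (dim S) \<le> int (d choose m) * (int M - int N)" if "uniquely_identifiable S ?Y"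
  proof -
    have "subspace S"
      by (simp add: S_def tensorized_subspace_def)
    then have "int D - int (dim S) \<le> (\<Sum>\<upsilon>\<in>?Y. int (card {k. \<upsilon> $ k = 1}) - int (dim (canonical_projection S \<upsilon>)))"
      using identifiable_codim_le[OF _ finY that] by (simp add: D)
    also have "\<dots> = int (card ?Y) * (int M - int N)"
      by (simp add: dimS ones)
    \<comment> \<open>Replacing the number of patterns by its upper bound is legitimate because the
      factor \<open>M - N\<close> is nonnegative.\<close>
    also have "\<dots> \<le> int (d choose m) * (int M - int N)"
      using cardY \<open>N \<le> M\<close> by (intro mult_right_mono) auto
    finally show ?thesis .
  qed
  then show "let S = (tensorized_subspace V :: (real ^ ('d, 'p) sym_idx) set); R = dim S
      in \<exists>R'. (\<forall>\<upsilon>\<in>tensorized_patterns m. dim (canonical_projection S \<upsilon>) = R') \<and> R' \<le> R \<and>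
        (uniquely_identifiable S (tensorized_patterns m) \<longrightarrow>
          int (d choose m) * (int M - int R') \<ge> int D - int R)"
    unfolding Let_def S_def[symmetric] using dimS \<open>N \<le> dim S\<close> by (intro exI[of _ N]) auto
qed

end
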